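(* Let $G$ and $H$ be connected graphs of order at least $2$. Then $${\rm gp}(H)\le \underline{{\rm gp}}_{\rm S}(G,H)\le {\rm gp}_{\rm S}(G,H)\le n(G)\,{\rm gp}(H).$$ Moreover, ${\rm gp}_{\rm S}(G,H)=n(G)\,{\rm gp}(H)$ if and only if ${\rm gp}(H)=\xi(H)$.
   Context: All graphs are finite, simple and connected; $n(G)=|V(G)|$. For vertices $x,y$, $d(x,y)$ is the distance and $I_H[x,y]=\{w: d_H(x,y)=d_H(x,w)+d_H(w,y)\}$. A set $X$ of vertices is a general position set if no shortest path contains more than two vertices of $X$; ${\rm gp}$ denotes the maximum cardinality of a general position set. For $u\in V(H)$, a set $S\subseteq V(H)$ is $u$-colinear if $S$ is a general position set of $H$, $u\notin S$, and $y\notin I_H[x,u]$ for all distinct $x,y\in S$; $\xi_H(u)$ is the maximum cardinality of a $u$-colinear set and $\xi(H)=\max_{u\in V(H)}\xi_H(u)$. For $f\colon V(G)\to V(H)$, the Sierpiński product $G\otimes_f H$ has vertex set $V(G)\times V(H)$ and edges $(g,h)(g,h')$ for $g\in V(G)$, $hh'\in E(H)$, and $(g,f(g'))(g',f(g))$ for $gg'\in E(G)$. Writing $H^G$ for the set of all functions $V(G)\to V(H)$, ${\rm gp}_{\rm S}(G,H)=\max_{f\in H^G}{\rm gp}(G\otimes_f H)$ and $\underline{{\rm gp}}_{\rm S}(G,H)=\min_{f\in H^G}{\rm gp}(G\otimes_f H)$. *)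

theory Defs
  imports "Graph_Theory.Graph_Theory" "HOL-Library.FuncSet"
begin

text \<open>
  A finite simple graph is a \<^const>\<open>pair_graph\<close>: an edge between \<open>u\<close> and \<open>v\<close> is the pair of
  arcs \<open>(u, v)\<close> and \<open>(v, u)\<close>.
\<close>

definition gdist :: "'a pair_pre_digraph \<Rightarrow> 'a \<Rightarrow> 'a \<Rightarrow> nat" where
  "gdist G x y = (LEAST n. \<exists>p. vpath p (with_proj G) \<and> hd p = x \<and> last p = y \<and> vwalk_length p = n)"

definition shortest_path :: "'a pair_pre_digraph \<Rightarrow> 'a vwalk \<Rightarrow> bool" where
  "shortest_path G p \<longleftrightarrow>
     vpath p (with_proj G) \<and> vwalk_length p = gdist G (hd p) (last p)"

definition interval :: "'a pair_pre_digraph \<Rightarrow> 'a \<Rightarrow> 'a \<Rightarrow> 'a set" where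
  "interval G x y = {w \<in> pverts G. gdist G x y = gdist G x w + gdist G w y}"

definition general_position :: "'a pair_pre_digraph \<Rightarrow> 'a set \<Rightarrow> bool" where
  "general_position G X \<longleftrightarrow>
     X \<subseteq> pverts G \<and> (\<forall>p. shortest_path G p \<longrightarrow> card (set p \<inter> X) \<le> 2)"

definition gp :: "'a pair_pre_digraph \<Rightarrow> nat" where
  "gp G = Max (card ` {X. general_position G X})"

definition colinear_set :: "'a pair_pre_digraph \<Rightarrow> 'a \<Rightarrow> 'a set \<Rightarrow> bool" where
  "colinear_set H u S \<longleftrightarrow>
     general_position H S \<and> u \<notin> S \<and>
     (\<forall>x\<in>S. \<forall>y\<in>S. x \<noteq> y \<longrightarrow> y \<notin> interval H x u)"

definition xi_at :: "'a pair_pre_digraph \<Rightarrow> 'a \<Rightarrow> nat" where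
  "xi_at H u = Max (card ` {S. colinear_set H u S})"

definition xi :: "'a pair_pre_digraph \<Rightarrow> nat" where
  "xi H = Max (xi_at H ` pverts H)"

definition sierpinski_product ::
  "'a pair_pre_digraph \<Rightarrow> ('a \<Rightarrow> 'b) \<Rightarrow> 'b pair_pre_digraph \<Rightarrow> ('a \<times> 'b) pair_pre_digraph" where
  "sierpinski_product G f H =
     \<lparr> pverts = pverts G \<times> pverts H,
       parcs = {((g, h), (g, h')) | g h h'. g \<in> pverts G \<and> (h, h') \<in> parcs H}
             \<union> {((g, f g'), (g', f g)) | g g'. (g, g') \<in> parcs G} \<rparr>"

text \<open>
  The functions \<open>V(G) \<rightarrow> V(H)\<close> form the extensional function space, so each is counted once
  and \<^const>\<open>Max\<close> and \<^const>\<open>Min\<close> range over finite sets.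
\<close>

definition gp_sierpinski :: "'a pair_pre_digraph \<Rightarrow> 'b pair_pre_digraph \<Rightarrow> nat" where
  "gp_sierpinski G H =
     Max ((\<lambda>f. gp (sierpinski_product G f H)) ` (pverts G \<rightarrow>\<^sub>E pverts H))"

definition lower_gp_sierpinski :: "'a pair_pre_digraph \<Rightarrow> 'b pair_pre_digraph \<Rightarrow> nat" where
  "lower_gp_sierpinski G H =
     Min ((\<lambda>f. gp (sierpinski_product G f H)) ` (pverts G \<rightarrow>\<^sub>E pverts H))"

lemma pair_graph_sierpinski_product:
  assumes "pair_graph G" "pair_graph H" "f \<in> pverts G \<rightarrow> pverts H"
  shows "pair_graph (sierpinski_product G f H)"
proof -
  interpret G: pair_graph G by fact
  interpret H: pair_graph H by fact
  let ?P = "sierpinski_product G f H"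
  have arcG: "g \<in> pverts G \<and> g' \<in> pverts G" if "(g, g') \<in> parcs G" for g g'
    using G.arc_fst_in_verts[OF that] G.arc_snd_in_verts[OF that] by simp
  have arcH: "h \<in> pverts H \<and> h' \<in> pverts H" if "(h, h') \<in> parcs H" for h h'
    using H.arc_fst_in_verts[OF that] H.arc_snd_in_verts[OF that] by simp
  have fH: "g \<in> pverts G \<Longrightarrow> f g \<in> pverts H" for g
    using assms(3) by blast
  have wf: "fst e \<in> pverts ?P \<and> snd e \<in> pverts ?P" if "e \<in> parcs ?P" for e
  proof -
    consider g h h' where "e = ((g, h), (g, h'))" "g \<in> pverts G" "(h, h') \<in> parcs H"
      | g g' where "e = ((g, f g'), (g', f g))" "(g, g') \<in> parcs G"
      using \<open>e \<in> parcs ?P\<close> by (auto simp: sierpinski_product_def)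
    then show ?thesis
    proof cases
      case 1
      then show ?thesis using arcH[of h h'] by (simp add: sierpinski_product_def)
    next
      case 2
      then show ?thesis using arcG[of g g'] fH[of g] fH[of g'] by (simp add: sierpinski_product_def)
    qed
  qed
  have fin: "finite (pverts ?P)"
    by (simp add: sierpinski_product_def G.pair_finite_verts H.pair_finite_verts)
  have "parcs ?P \<subseteq> pverts ?P \<times> pverts ?P"
    using wf by (auto simp: mem_Times_iff)
  then have fina: "finite (parcs ?P)"
    using fin finite_subset by blast
  have loop: "e \<in> parcs ?P \<Longrightarrow> fst e \<noteq> snd e" for e
    using G.pair_no_loops H.pair_no_loops by (fastforce simp: sierpinski_product_def)
  have "sym (parcs G)" "sym (parcs H)"
    using G.pair_sym_arcs H.pair_sym_arcs by (simp_all add: symmetric_def)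
  then have "symmetric (with_proj ?P)"
    by (auto simp: symmetric_def sym_def sierpinski_product_def)
  then show ?thesis
    using wf fin fina loop by unfold_locales auto
qed

end

theory Submission
  imports Defs
begin

text \<open>
  All distances in the product are bounded from below by exhibiting integer potentials that grow by
  at most one along every arc. A linking arc joins \<open>(a, f a')\<close> and \<open>(a', f a)\<close>, so any
  expression symmetric in \<open>b\<close> and \<open>f a\<close> takes the same value at both of its ends.
  Such a potential shows that every copy of \<open>H\<close> is isometric in the product. Hence a
  general position set of the product is, fibre by fibre, one of \<open>H\<close>, and this gives both
  bounds.

  If \<open>S\<close> is \<open>u\<close>-colinear, then \<open>V(G) \<times> S\<close> is in general position for the constant map
  \<open>u\<close>. Conversely, let \<open>X\<close> meet every fibre in \<open>gp(H)\<close> vertices. A geodesic between the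
  fibres over adjacent vertices need not use the arc linking them. However, given
  \<open>(j, z) \<in> X\<close>, choose a neighbour \<open>i\<close> of \<open>j\<close> that minimises
  \<open>d(z, f i) - d(f j, f i)\<close>. Then from \<open>(j, z)\<close> every vertex of the fibre over \<open>i\<close> is reached
  by a geodesic through the arc linking \<open>j\<close> to \<open>i\<close>, which makes that fibre of \<open>X\<close>
  \<open>f j\<close>-colinear.
\<close>

section \<open>Walks, paths and distances\<close>

text \<open>Turning a walk into a path cuts out the closed detours, and each repeated vertex costs
  at least one entry. This lets arbitrary walks bound \<open>gdist\<close>, which is defined through
  paths.\<close>

lemma length_vwalk_to_vpath: "length (vwalk_to_vpath p) \<le> length p"
  "\<not> distinct p \<Longrightarrow> length (vwalk_to_vpath p) < length p"
proof -
  have "length (vwalk_to_vpath p) \<le> length p \<and>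
    (\<not> distinct p \<longrightarrow> length (vwalk_to_vpath p) < length p)"
  proof (induct p rule: vwalk_to_vpath_induct3)
    case (in_set x xs)
    then show ?case
      using length_dropWhile_le[of "\<lambda>y. y \<noteq> x" xs] by auto
  qed auto
  then show "length (vwalk_to_vpath p) \<le> length p"
    "\<not> distinct p \<Longrightarrow> length (vwalk_to_vpath p) < length p" by auto
qed

locale connected_graph = pair_graph +
  assumes conn: "connected (with_proj G)"
begin

lemma reachable_verts:
  assumes "x \<in> pverts G" "y \<in> pverts G"
  shows "x \<rightarrow>\<^sup>*\<^bsub>with_proj G\<^esub> y"
  using symmetric_connected_imp_strongly_connected[OF pair_sym_arcs conn] assms
  by (auto simp: strongly_connected_def)

lemma verts_induct:
  assumes "x \<in> pverts G" "y \<in> pverts G" "P x"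
    and "\<And>u v. (u, v) \<in> parcs G \<Longrightarrow> P u \<Longrightarrow> P v"
  shows "P y"
  using reachable_verts[OF assms(1,2)]
proof (induct rule: reachable_induct)
  case base
  show ?case by (rule assms(3))
next
  case (step u v)
  then show ?case using assms(4) by auto
qed

text \<open>Connectedness makes the set under \<open>LEAST\<close> nonempty, so the minimum is
  attained. The \<open>Suc\<close> arises because \<open>vwalk_length\<close> counts arcs and
  \<open>length\<close> counts vertices.\<close>

lemma gdist_path:
  assumes "x \<in> pverts G" "y \<in> pverts G"
  obtains p where "vpath p (with_proj G)" "hd p = x" "last p = y" "length p = Suc (gdist G x y)"
proof -
  let ?Q = "\<lambda>n. \<exists>p. vpath p (with_proj G) \<and> hd p = x \<and> last p = y \<and> vwalk_length p = n"
  have "\<exists>n. ?Q n"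
    using reachable_verts[OF assms] by (auto simp: reachable_vpath_conv)
  then have "?Q (gdist G x y)"
    unfolding gdist_def by (rule LeastI_ex)
  then obtain p where p: "vpath p (with_proj G)" "hd p = x" "last p = y"
    "length p - 1 = gdist G x y" by auto
  moreover from p(1) have "p \<noteq> []" by auto
  ultimately show thesis using that[of p] by (cases p) auto
qed

lemma gdist_le_vpath:
  assumes "vpath p (with_proj G)"
  shows "gdist G (hd p) (last p) \<le> length p - 1"
  unfolding gdist_def by (rule Least_le) (use assms in auto)

lemma gdist_le_vwalk:
  assumes "vwalk p (with_proj G)"
  shows "gdist G (hd p) (last p) \<le> length p - 1"
  using gdist_le_vpath[OF vwalk_to_vpath_vpath[OF assms]] length_vwalk_to_vpath(1)[of p]
  by (simp add: vwalk_to_vpath_hd vwalk_to_vpath_last)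

text \<open>A repeated vertex could be cut out, leaving a path with the same ends that is shorter
  than their distance. This is what makes a concatenation of two geodesics a path.\<close>

lemma vwalk_length_gdist_imp_vpath:
  assumes "vwalk p (with_proj G)" "length p = Suc (gdist G (hd p) (last p))"
  shows "vpath p (with_proj G)"
proof (rule vpathI[OF assms(1)], rule ccontr)
  assume "\<not> distinct p"
  then have "length (vwalk_to_vpath p) \<le> gdist G (hd p) (last p)"
    using length_vwalk_to_vpath(2)[of p] assms(2) by simp
  moreover have "gdist G (hd p) (last p) \<le> length (vwalk_to_vpath p) - 1"
    using gdist_le_vpath[OF vwalk_to_vpath_vpath[OF assms(1)]]
    by (simp add: vwalk_to_vpath_hd vwalk_to_vpath_last)
  moreover have "vwalk_to_vpath p \<noteq> []"
    using assms(1) by (intro vwalk_to_vpath_nonempty) auto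
  then have "length (vwalk_to_vpath p) > 0" by simp
  ultimately show False by linarith
qed

text \<open>Summing the increments along a geodesic gives the bound. It serves both directions: an
  explicit \<open>\<phi>\<close> bounds a distance from below, and a \<open>\<phi>\<close> that is
  itself a distance function gives an upper bound. Values are integers since potentials may be
  negative.\<close>

lemma gdist_lipschitz:
  fixes \<phi> :: "'a \<Rightarrow> int"
  assumes "x \<in> pverts G" "y \<in> pverts G"
    and lip: "\<And>u v. (u, v) \<in> parcs G \<Longrightarrow> \<phi> v \<le> \<phi> u + 1"
  shows "\<phi> y \<le> \<phi> x + int (gdist G x y)"
proof -
  obtain p where p: "vpath p (with_proj G)" "hd p = x" "last p = y"
    "length p = Suc (gdist G x y)"
    using gdist_path assms by blast
  from p(1) have "vwalk p (with_proj G)" by auto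
  then have "\<phi> (last p) + 1 \<le> \<phi> (hd p) + int (length p)"
  proof (induct p)
    case (Cons u v es)
    then show ?case using lip[of u v] by auto
  qed simp
  with p show ?thesis by simp
qed

lemma gdist_self [simp]: "x \<in> pverts G \<Longrightarrow> gdist G x x = 0"
  using gdist_le_vpath[OF vpath_self[of x "with_proj G"]] by simp

lemma gdist_eq_0_iff:
  assumes "x \<in> pverts G" "y \<in> pverts G"
  shows "gdist G x y = 0 \<longleftrightarrow> x = y"
proof
  assume "gdist G x y = 0"
  then obtain p where "hd p = x" "last p = y" "length p = 1"
    using gdist_path[OF assms] by auto
  then show "x = y" by (cases p) auto
qed (use assms in simp)

lemma gdist_triangle:
  assumes "x \<in> pverts G" "y \<in> pverts G" "z \<in> pverts G"
  shows "gdist G x z \<le> gdist G x y + gdist G y z"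
proof -
  obtain p where p: "vpath p (with_proj G)" "hd p = x" "last p = y"
    "length p = Suc (gdist G x y)" using gdist_path assms by blast
  obtain q where q: "vpath q (with_proj G)" "hd q = y" "last q = z"
    "length q = Suc (gdist G y z)" using gdist_path assms by blast
  have j: "joinable p q" using p q by (auto simp: joinable_def)
  have "vwalk (p \<oplus> q) (with_proj G)"
    using p q by (intro vwalk_joinI_vwalk[OF _ _ j]) auto
  from gdist_le_vwalk[OF this] show ?thesis
    using vwalk_join_vwalk_length[OF j] vwalk_join_hd[OF j] vwalk_join_last[OF j] p q
    by simp
qed

lemma gdist_arc:
  assumes "(x, y) \<in> parcs G"
  shows "gdist G x y \<le> 1"
  using gdist_le_vpath[of "[x, y]"] assms in_arcsD1[OF assms] in_arcsD2[OF assms] no_loops'[OF assms]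
  by (auto simp: vpath_def vwalk_def)

lemma gdist_commute:
  assumes "x \<in> pverts G" "y \<in> pverts G"
  shows "gdist G x y = gdist G y x"
proof -
  have "gdist G y x \<le> gdist G x y" if "x \<in> pverts G" "y \<in> pverts G" for x y
  proof -
    have "int (gdist G v x) \<le> int (gdist G u x) + 1" if uv: "(u, v) \<in> parcs G" for u v
      using gdist_triangle[of v u x] gdist_arc[OF arcs_symmetric[OF uv]] \<open>x \<in> pverts G\<close>
        in_arcsD1[OF uv] in_arcsD2[OF uv] by simp
    then have "int (gdist G y x) \<le> int (gdist G x x) + int (gdist G x y)"
      by (rule gdist_lipschitz[of x y "\<lambda>v. int (gdist G v x)", OF that])
    then show ?thesis using that by simp
  qed
  with assms show ?thesis by (meson antisym)
qed

lemma gdist_arc_le: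
  assumes "x \<in> pverts G" "(u, v) \<in> parcs G"
  shows "gdist G x v \<le> gdist G x u + 1"
  using gdist_triangle[of x u v] gdist_arc[OF assms(2)] in_arcsD1[OF assms(2)]
    in_arcsD2[OF assms(2)] assms(1) by simp

text \<open>Each segment of the path bounds the distance of its ends from above. The three segments
  cut at \<open>i\<close> and \<open>j\<close> add up to the distance of the outer ends, so the
  triangle inequality leaves no slack in any of them.\<close>

lemma shortest_path_gdist_nth:
  assumes p: "shortest_path G p" and ij: "i \<le> j" "j < length p"
  shows "gdist G (p ! i) (p ! j) = j - i"
proof -
  have w: "vwalk p (with_proj G)" and "length p - 1 = gdist G (hd p) (last p)"
    using p by (simp_all add: shortest_path_def vpath_def)
  then have len: "length p = Suc (gdist G (hd p) (last p))" using ij by linarith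
  have upper: "gdist G (p ! a) (p ! b) \<le> b - a" if "a \<le> b" "b < length p" for a b
  proof -
    let ?q = "drop a (take (Suc b) p)"
    have "vwalk (take (Suc b) p) (with_proj G)"
      using vwalkI_append_l[of "take (Suc b) p" "drop (Suc b) p"] w that by fastforce
    then have "vwalk ?q (with_proj G)"
      using vwalkI_append_r[of ?q "take a (take (Suc b) p)"] that
      unfolding append_take_drop_id by simp
    from gdist_le_vwalk[OF this] show ?thesis
      using that by (simp add: hd_drop_conv_nth last_conv_nth min_absorb2 Suc_leI)
  qed
  have v: "p ! k \<in> pverts G" if "k < length p" for k
    using w that by (auto simp: vwalk_def)
  have ends: "hd p = p ! 0" "last p = p ! (length p - 1)"
    using ij by (metis hd_conv_nth last_conv_nth list.size(3) not_less_zero)+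
  have "gdist G (p ! 0) (p ! (length p - 1)) \<le>
      gdist G (p ! 0) (p ! i) + (gdist G (p ! i) (p ! j) + gdist G (p ! j) (p ! (length p - 1)))"
    using ij gdist_triangle[of "p ! 0" "p ! i" "p ! (length p - 1)"]
      gdist_triangle[of "p ! i" "p ! j" "p ! (length p - 1)"] v[of 0] v[of i] v[of j]
      v[of "length p - 1"] by fastforce
  moreover have "gdist G (p ! 0) (p ! (length p - 1)) = length p - 1"
    using len unfolding ends by simp
  ultimately show ?thesis
    using upper[of 0 i] upper[of i j] upper[of j "length p - 1"] ij by linarith
qed

section \<open>General position in terms of distances\<close>

text \<open>If distances add up at \<open>y\<close>, geodesics from \<open>x\<close> to
  \<open>y\<close> and from \<open>y\<close> to \<open>z\<close> join to a geodesic through all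
  three. Conversely, of three vertices on a geodesic the middle one splits the distance of the other
  two. From here on only distances matter, not paths.\<close>

lemma general_position_iff:
  "general_position G X \<longleftrightarrow> X \<subseteq> pverts G \<and>
    (\<forall>x\<in>X. \<forall>y\<in>X. \<forall>z\<in>X. x \<noteq> y \<longrightarrow> y \<noteq> z \<longrightarrow> x \<noteq> z \<longrightarrow>
      gdist G x z \<noteq> gdist G x y + gdist G y z)"
  (is "_ \<longleftrightarrow> _ \<and> ?T")
proof (intro iffI conjI)
  assume gpX: "general_position G X"
  then show X: "X \<subseteq> pverts G" by (simp add: general_position_def)
  show ?T
  proof (intro ballI impI notI)
    fix x y z assume xyz: "x \<in> X" "y \<in> X" "z \<in> X" "x \<noteq> y" "y \<noteq> z" "x \<noteq> z"
      and d: "gdist G x z = gdist G x y + gdist G y z"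
    obtain p where p: "vpath p (with_proj G)" "hd p = x" "last p = y"
      "length p = Suc (gdist G x y)" using gdist_path xyz X by blast
    obtain q where q: "vpath q (with_proj G)" "hd q = y" "last q = z"
      "length q = Suc (gdist G y z)" using gdist_path xyz X by blast
    have j: "joinable p q" using p q by (auto simp: joinable_def)
    have ends: "hd (p \<oplus> q) = x" "last (p \<oplus> q) = z"
      using vwalk_join_hd[OF j] vwalk_join_last[OF j] p q by auto
    have len: "length (p \<oplus> q) = Suc (gdist G x z)"
      using p q d by (simp add: vwalk_join_def)
    have "vwalk (p \<oplus> q) (with_proj G)"
      using p q by (intro vwalk_joinI_vwalk[OF _ _ j]) auto
    then have "vpath (p \<oplus> q) (with_proj G)"
      using len ends by (intro vwalk_length_gdist_imp_vpath) auto
    then have "shortest_path G (p \<oplus> q)"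
      using len ends by (simp add: shortest_path_def)
    then have le: "card (set (p \<oplus> q) \<inter> X) \<le> 2"
      using gpX by (simp add: general_position_def)
    have ne: "p \<noteq> []" "q \<noteq> []" using p q by auto
    have "x \<in> set p" "y \<in> set p" using p ne hd_in_set[of p] last_in_set[of p] by auto
    moreover have "z \<in> set (p \<oplus> q)" using ends(2) ne last_in_set[of "p \<oplus> q"] by auto
    ultimately have "{x, y, z} \<subseteq> set (p \<oplus> q) \<inter> X"
      using xyz by (auto simp: vwalk_join_def)
    then have "card {x, y, z} \<le> card (set (p \<oplus> q) \<inter> X)"
      by (intro card_mono) auto
    with le xyz show False by auto
  qed
next
  assume A: "X \<subseteq> pverts G \<and> ?T"
  have "card (set p \<inter> X) \<le> 2" if p: "shortest_path G p" for p
  proof (rule ccontr)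
    have key: False if "i < j" "j < k" "k < length p" "p ! i \<in> X" "p ! j \<in> X" "p ! k \<in> X" for i j k
    proof -
      have "gdist G (p ! i) (p ! k) = gdist G (p ! i) (p ! j) + gdist G (p ! j) (p ! k)"
        using that by (simp add: shortest_path_gdist_nth[OF p])
      moreover have "distinct p" using p by (auto simp: shortest_path_def)
      ultimately show False using A that by (auto simp: nth_eq_iff_index_eq)
    qed
    assume "\<not> card (set p \<inter> X) \<le> 2"
    then have "3 \<le> card (set p \<inter> X)" by simp
    then obtain T where T: "T \<subseteq> set p \<inter> X" "card T = 3"
      by (rule obtain_subset_with_card_n)
    from T(2) obtain a b c where abc: "T = {a, b, c}" "a \<noteq> b" "b \<noteq> c" "a \<noteq> c"
      unfolding card_3_iff by blast
    have "a \<in> set p" "b \<in> set p" "c \<in> set p" and X: "a \<in> X" "b \<in> X" "c \<in> X"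
      using T(1) abc(1) by auto
    then obtain i j k where ijk: "i < length p" "j < length p" "k < length p"
      "a = p ! i" "b = p ! j" "c = p ! k"
      unfolding in_set_conv_nth by metis
    with abc have "i \<noteq> j" "j \<noteq> k" "i \<noteq> k" by auto
    \<comment> \<open>\<open>key\<close> wants increasing indices, so all six orders of
      \<open>i\<close>, \<open>j\<close>, \<open>k\<close> are offered.\<close>
    with ijk X show False
      using key[of i j k] key[of i k j] key[of j i k] key[of j k i] key[of k i j] key[of k j i]
      by (metis linorder_neqE_nat)
  qed
  with A show "general_position G X" by (simp add: general_position_def)
qed

section \<open>The maxima \<open>gp\<close> and \<open>xi\<close>\<close>

lemma finite_general_position_sets: "finite {X. general_position G X}"
  by (rule finite_subset[of _ "Pow (pverts G)"])
    (use pair_finite_verts in \<open>auto simp: general_position_def\<close>)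

lemma general_position_subset_verts: "general_position G X \<Longrightarrow> X \<subseteq> pverts G"
  by (simp add: general_position_def)

lemma general_position_empty: "general_position G {}"
  by (simp add: general_position_def)

lemma card_le_gp: "general_position G X \<Longrightarrow> card X \<le> gp G"
  unfolding gp_def using finite_general_position_sets by (intro Max_ge) auto

lemma gp_attained:
  obtains X where "general_position G X" "card X = gp G"
proof -
  have "gp G \<in> card ` {X. general_position G X}"
    unfolding gp_def using finite_general_position_sets general_position_empty
    by (intro Max_in) auto
  then show thesis using that by auto
qed

text \<open>Any two vertices are in general position, because no path can contain more than two
  elements of a pair.\<close>

lemma gp_ge_2:
  assumes "card (pverts G) \<ge> 2"
  shows "gp G \<ge> 2"
proof -
  obtain X where X: "X \<subseteq> pverts G" "card X = 2" "finite X"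
    using obtain_subset_with_card_n[OF assms] by blast
  have "card (set p \<inter> X) \<le> 2" for p
    using card_mono[OF X(3), of "set p \<inter> X"] X(2) by auto
  with X card_le_gp[of X] show ?thesis by (simp add: general_position_def)
qed

lemma colinear_set_general_position: "colinear_set G u S \<Longrightarrow> general_position G S"
  by (simp add: colinear_set_def)

lemma colinear_set_empty: "colinear_set G u {}"
  by (simp add: colinear_set_def general_position_empty)

lemma finite_colinear_sets: "finite {S. colinear_set G u S}"
  by (rule finite_subset[OF _ finite_general_position_sets])
    (auto dest: colinear_set_general_position)

lemma xi_le_gp:
  assumes "pverts G \<noteq> {}"
  shows "xi G \<le> gp G"
proof -
  have "xi_at G u \<le> gp G" for u
    unfolding xi_at_def
    using finite_colinear_sets[of u] colinear_set_empty card_le_gp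
    by (subst Max_le_iff) (auto dest: colinear_set_general_position)
  then show ?thesis
    unfolding xi_def using assms pair_finite_verts by (subst Max_le_iff) auto
qed

lemma card_colinear_le_xi:
  assumes "u \<in> pverts G" "colinear_set G u S"
  shows "card S \<le> xi G"
proof -
  have "card S \<le> xi_at G u"
    unfolding xi_at_def using finite_colinear_sets[of u] assms by (intro Max_ge) auto
  also have "\<dots> \<le> xi G"
    unfolding xi_def using assms pair_finite_verts by (intro Max_ge) auto
  finally show ?thesis .
qed

lemma xi_attained:
  assumes "pverts G \<noteq> {}"
  obtains u S where "u \<in> pverts G" "colinear_set G u S" "card S = xi G"
proof -
  have "xi G \<in> xi_at G ` pverts G"
    unfolding xi_def using assms pair_finite_verts by (intro Max_in) auto
  then obtain u where u: "u \<in> pverts G" "xi G = xi_at G u" by auto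
  have "xi_at G u \<in> card ` {S. colinear_set G u S}"
    unfolding xi_at_def using finite_colinear_sets[of u] colinear_set_empty
    by (intro Max_in) auto
  then show thesis using that u by auto
qed

end

section \<open>The Sierpinski product and its connectedness\<close>

locale sierpinski = G: connected_graph G + H: connected_graph H
  for G :: "'a pair_pre_digraph" and H :: "'b pair_pre_digraph" +
  fixes f :: "'a \<Rightarrow> 'b"
  assumes f_verts: "f \<in> pverts G \<rightarrow> pverts H"
begin

abbreviation P :: "('a \<times> 'b) pair_pre_digraph" where
  "P \<equiv> sierpinski_product G f H"

lemma f_in [simp]: "a \<in> pverts G \<Longrightarrow> f a \<in> pverts H"
  using f_verts by blast

lemma verts_P [simp]: "pverts P = pverts G \<times> pverts H"
  by (simp add: sierpinski_product_def)

lemma fiber_arc: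
  assumes "a \<in> pverts G" "(b, b') \<in> parcs H"
  shows "((a, b), (a, b')) \<in> parcs P"
  using assms by (auto simp: sierpinski_product_def)

lemma link_arc:
  assumes "(a, a') \<in> parcs G"
  shows "((a, f a'), (a', f a)) \<in> parcs P"
  using assms by (auto simp: sierpinski_product_def)

lemma arc_P_cases:
  assumes "(p, q) \<in> parcs P"
  obtains (fiber) a b b' where "p = (a, b)" "q = (a, b')" "a \<in> pverts G" "(b, b') \<in> parcs H"
  | (link) a a' where "p = (a, f a')" "q = (a', f a)" "(a, a') \<in> parcs G"
  using assms by (auto simp: sierpinski_product_def)

text \<open>A walk of \<open>H\<close> lifts to every fibre. Induction along arcs
  \<open>(u, v)\<close> of \<open>G\<close> then carries reachability over: move to
  \<open>(u, f v)\<close>, cross the link to \<open>(v, f u)\<close>, and spread through the new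
  fibre.\<close>

lemma connected_graph_P: "connected_graph P"
proof -
  interpret P: pair_graph P
    using pair_graph_sierpinski_product G.pair_graph H.pair_graph f_verts by blast
  have fiber: "(a, b) \<rightarrow>\<^sup>*\<^bsub>with_proj P\<^esub> (a, b')"
    if "a \<in> pverts G" "b \<in> pverts H" "b' \<in> pverts H" for a b b'
    using that(2,3)
  proof (rule H.verts_induct)
    show "(a, b) \<rightarrow>\<^sup>*\<^bsub>with_proj P\<^esub> (a, b)" using that by (intro P.reachable_refl) simp
    show "(a, b) \<rightarrow>\<^sup>*\<^bsub>with_proj P\<^esub> (a, v)"
      if "(u, v) \<in> parcs H" "(a, b) \<rightarrow>\<^sup>*\<^bsub>with_proj P\<^esub> (a, u)" for u v
      using that(2) P.reachable_adjI[of "(a, u)" "(a, v)"] fiber_arc[OF \<open>a \<in> pverts G\<close> that(1)]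
      by (auto intro: P.reachable_trans)
  qed
  have all: "(a, b) \<rightarrow>\<^sup>*\<^bsub>with_proj P\<^esub> (a', b')"
    if "a \<in> pverts G" "b \<in> pverts H" "a' \<in> pverts G" "b' \<in> pverts H" for a b a' b'
  proof -
    have "\<forall>b'\<in>pverts H. (a, b) \<rightarrow>\<^sup>*\<^bsub>with_proj P\<^esub> (a', b')"
      using that(1,3)
    proof (rule G.verts_induct)
      show "\<forall>b'\<in>pverts H. (a, b) \<rightarrow>\<^sup>*\<^bsub>with_proj P\<^esub> (a, b')" using fiber that by blast
    next
      fix u v assume uv: "(u, v) \<in> parcs G"
        and IH: "\<forall>b'\<in>pverts H. (a, b) \<rightarrow>\<^sup>*\<^bsub>with_proj P\<^esub> (u, b')"
      have u: "u \<in> pverts G" "v \<in> pverts G"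
        using G.in_arcsD1[OF uv] G.in_arcsD2[OF uv] by auto
      have "(u, f v) \<rightarrow>\<^sup>*\<^bsub>with_proj P\<^esub> (v, f u)"
        using P.reachable_adjI link_arc[OF uv] by simp
      moreover have "(a, b) \<rightarrow>\<^sup>*\<^bsub>with_proj P\<^esub> (u, f v)" using IH u by simp
      ultimately have "(a, b) \<rightarrow>\<^sup>*\<^bsub>with_proj P\<^esub> (v, f u)" by (blast intro: P.reachable_trans)
      then show "\<forall>b'\<in>pverts H. (a, b) \<rightarrow>\<^sup>*\<^bsub>with_proj P\<^esub> (v, b')"
        using fiber[of v "f u"] u by (auto intro: P.reachable_trans)
    qed
    with that show ?thesis by blast
  qed
  have "pverts G \<noteq> {}" "pverts H \<noteq> {}"
    using G.conn H.conn by (auto simp: connected_def strongly_connected_def)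
  \<comment> \<open>\<open>connected\<close> means strong connectedness of the symmetric closure, so
    reachability in \<open>P\<close> is lifted there.\<close>
  then have "connected (with_proj P)"
    unfolding connected_def
    by (intro strongly_connectedI) (auto intro!: P.reachable_mk_symmetricI all)
  then show ?thesis
    by unfold_locales
qed

sublocale P: connected_graph P
  by (rule connected_graph_P)

section \<open>Isometric fibres and the fibrewise bounds\<close>

lemma gdist_fiber:
  assumes a: "a \<in> pverts G" and b: "b \<in> pverts H" "b' \<in> pverts H"
  shows "gdist P (a, b) (a, b') = gdist H b b'"
proof (rule antisym)
  have "int (gdist P (a, b) (a, b')) \<le> int (gdist P (a, b) (a, b)) + int (gdist H b b')"
    using b
  proof (rule H.gdist_lipschitz[where \<phi> = "\<lambda>v. int (gdist P (a, b) (a, v))"])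
    fix u v assume "(u, v) \<in> parcs H"
    then show "int (gdist P (a, b) (a, v)) \<le> int (gdist P (a, b) (a, u)) + 1"
      using P.gdist_arc_le[of "(a, b)" "(a, u)" "(a, v)"] fiber_arc a b by simp
  qed
  then show "gdist P (a, b) (a, b') \<le> gdist H b b'" using a b by simp
next
  \<comment> \<open>Swapping \<open>d\<close> with \<open>f c\<close> exchanges the two terms of the
    minimum, so \<open>\<phi>\<close> is constant along links. On the fibre over \<open>a\<close>
    the first term is the smaller one by the triangle inequality, and \<open>\<phi>\<close> is there
    the distance from \<open>b\<close> in \<open>H\<close>.\<close>
  define \<phi> where "\<phi> = (\<lambda>(c, d).
    min (int (gdist H b d) + int (gdist H (f a) (f c))) (int (gdist H b (f c)) + int (gdist H (f a) d)))"
  have "\<phi> (a, b') \<le> \<phi> (a, b) + int (gdist P (a, b) (a, b'))"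
  proof (rule P.gdist_lipschitz)
    fix p q assume "(p, q) \<in> parcs P"
    then show "\<phi> q \<le> \<phi> p + 1"
    proof (cases rule: arc_P_cases)
      case (fiber c d d')
      then show ?thesis
        using H.gdist_arc_le[of b d d'] H.gdist_arc_le[of "f a" d d'] a b by (simp add: \<phi>_def)
    next
      case (link c c')
      then show ?thesis by (simp add: \<phi>_def)
    qed
  qed (use a b in auto)
  moreover have "\<phi> (a, b) = 0" "\<phi> (a, b') = int (gdist H b b')"
    using a b H.gdist_triangle[of b "f a" b'] by (simp_all add: \<phi>_def)
  ultimately show "gdist H b b' \<le> gdist P (a, b) (a, b')" by simp
qed

text \<open>Fibres are isometric copies of \<open>H\<close>, so the distance criterion passes from
  \<open>X\<close> to its slices.\<close>

lemma general_position_fiber: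
  assumes X: "general_position P X" and a: "a \<in> pverts G"
  shows "general_position H (Pair a -` X)"
proof -
  have sub: "X \<subseteq> pverts G \<times> pverts H"
    using P.general_position_subset_verts[OF X] by simp
  have "gdist H x z \<noteq> gdist H x y + gdist H y z"
    if "(a, x) \<in> X" "(a, y) \<in> X" "(a, z) \<in> X" "x \<noteq> y" "y \<noteq> z" "x \<noteq> z" for x y z
  proof -
    have "gdist P (a, x) (a, z) \<noteq> gdist P (a, x) (a, y) + gdist P (a, y) (a, z)"
      using X that unfolding P.general_position_iff by blast
    moreover have "x \<in> pverts H" "y \<in> pverts H" "z \<in> pverts H" using sub that by auto
    ultimately show ?thesis using a by (simp add: gdist_fiber)
  qed
  then show ?thesis
    using sub by (auto simp: H.general_position_iff)
qed

lemma general_position_copy: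
  assumes S: "general_position H S" and a: "a \<in> pverts G"
  shows "general_position P ({a} \<times> S)"
proof -
  have sub: "S \<subseteq> pverts H" by (rule H.general_position_subset_verts[OF S])
  have "gdist P (a, x) (a, z) \<noteq> gdist P (a, x) (a, y) + gdist P (a, y) (a, z)"
    if "x \<in> S" "y \<in> S" "z \<in> S" "x \<noteq> y" "y \<noteq> z" "x \<noteq> z" for x y z
  proof -
    have "gdist H x z \<noteq> gdist H x y + gdist H y z"
      using S that unfolding H.general_position_iff by blast
    moreover have "x \<in> pverts H" "y \<in> pverts H" "z \<in> pverts H" using sub that by auto
    ultimately show ?thesis using a by (simp add: gdist_fiber)
  qed
  then show ?thesis
    using sub a by (auto simp: P.general_position_iff)
qed

lemma card_eq_sum_fibers:
  assumes "X \<subseteq> pverts G \<times> pverts H"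
  shows "card X = (\<Sum>a\<in>pverts G. card (Pair a -` X))"
proof -
  have "X = (SIGMA a:pverts G. Pair a -` X)" using assms by auto
  moreover have "finite (Pair a -` X)" for a
    by (rule finite_subset[OF _ H.pair_finite_verts]) (use assms in auto)
  ultimately show ?thesis
    using card_SigmaI[OF G.pair_finite_verts, of "\<lambda>a. Pair a -` X"] by simp
qed

lemma gp_le_gp_P: "gp H \<le> gp P"
proof -
  obtain a where a: "a \<in> pverts G"
    using G.conn by (auto simp: connected_def strongly_connected_def)
  obtain S where S: "general_position H S" "card S = gp H"
    by (rule H.gp_attained)
  show ?thesis
    using P.card_le_gp[OF general_position_copy[OF S(1) a]] S(2)
    by (simp add: card_cartesian_product_singleton)
qed

lemma gp_P_le: "gp P \<le> card (pverts G) * gp H"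
proof -
  obtain X where X: "general_position P X" "card X = gp P"
    by (rule P.gp_attained)
  have "card X = (\<Sum>a\<in>pverts G. card (Pair a -` X))"
    using P.general_position_subset_verts[OF X(1)] by (intro card_eq_sum_fibers) simp
  also have "\<dots> \<le> (\<Sum>a\<in>pverts G. gp H)"
    by (intro sum_mono H.card_le_gp general_position_fiber X(1))
  finally show ?thesis using X by simp
qed

section \<open>Neighbouring fibres and colinear slices\<close>

text \<open>The path through the link from \<open>j\<close> to \<open>i\<close> gives the upper
  bound. The premise \<open>le\<close> makes \<open>i\<close> the best exit from the fibre over
  \<open>j\<close>, so that no detour through another neighbour \<open>k\<close> is shorter.\<close>

lemma gdist_neighbour:
  assumes ji: "(j, i) \<in> parcs G" and z: "z \<in> pverts H" and x: "x \<in> pverts H"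
    and le: "\<And>k. (j, k) \<in> parcs G \<Longrightarrow>
      int (gdist H z (f i)) - int (gdist H (f j) (f i)) \<le> int (gdist H z (f k)) - int (gdist H (f j) (f k))"
  shows "gdist P (j, z) (i, x) = gdist H z (f i) + 1 + gdist H (f j) x"
proof (rule antisym)
  have v: "i \<in> pverts G" "j \<in> pverts G" using G.in_arcsD1[OF ji] G.in_arcsD2[OF ji] by auto
  have "gdist P (j, z) (i, x) \<le> gdist P (j, z) (i, f j) + gdist P (i, f j) (i, x)"
    using v z x by (intro P.gdist_triangle) auto
  moreover have "gdist P (j, z) (i, f j) \<le> gdist P (j, z) (j, f i) + 1"
    using link_arc[OF ji] v z by (intro P.gdist_arc_le) auto
  ultimately show "gdist P (j, z) (i, x) \<le> gdist H z (f i) + 1 + gdist H (f j) x"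
    using v z x by (simp add: gdist_fiber)
  \<comment> \<open>\<open>\<mu>\<close> is the minimal value in \<open>le\<close>. Away from
    \<open>j\<close> the potential is symmetric in \<open>b\<close> and \<open>f a\<close>, hence
    constant along links. On a link leaving \<open>j\<close>, \<open>le\<close> makes the second
    term the minimum, so \<open>\<phi>\<close> rises by exactly one. The first term keeps
    \<open>\<phi>\<close> at most 0 at \<open>(j, z)\<close>.\<close>
  define \<mu> where "\<mu> = int (gdist H z (f i)) - int (gdist H (f j) (f i))"
  define \<phi> where "\<phi> = (\<lambda>(a, b).
    if a = j then min (int (gdist H z b)) (\<mu> + int (gdist H (f j) b))
    else 1 + \<mu> + int (gdist H (f j) b) + int (gdist H (f j) (f a)))"
  have "\<phi> (i, x) \<le> \<phi> (j, z) + int (gdist P (j, z) (i, x))"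
  proof (rule P.gdist_lipschitz)
    fix p q assume "(p, q) \<in> parcs P"
    then show "\<phi> q \<le> \<phi> p + 1"
    proof (cases rule: arc_P_cases)
      case (fiber a b b')
      then show ?thesis
        using H.gdist_arc_le[of z b b'] H.gdist_arc_le[of "f j" b b'] v z
        by (auto simp: \<phi>_def min_def)
    next
      case (link a a')
      moreover have "a \<noteq> a'" using G.no_loops'[OF link(3)] .
      moreover have "\<mu> + int (gdist H (f j) (f a')) \<le> int (gdist H z (f a'))" if "a = j"
        using le[of a'] link(3) that by (simp add: \<mu>_def)
      ultimately show ?thesis
        using v by (cases "a = j"; cases "a' = j") (auto simp: \<phi>_def)
    qed
  qed (use v z x in auto)
  moreover have "\<phi> (j, z) \<le> 0" using z by (simp add: \<phi>_def)
  moreover have "\<phi> (i, x) = int (gdist H z (f i)) + 1 + int (gdist H (f j) x)"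
    using G.no_loops'[OF ji] by (simp add: \<phi>_def \<mu>_def)
  ultimately show "gdist H z (f i) + 1 + gdist H (f j) x \<le> gdist P (j, z) (i, x)" by simp
qed

text \<open>For the optimal neighbour \<open>i\<close>, the distance from \<open>(j, z)\<close> to
  \<open>(i, x)\<close> is a constant plus the distance from \<open>f j\<close> to \<open>x\<close>.
  So if \<open>y\<close> lay between \<open>x\<close> and \<open>f j\<close>, then
  \<open>(i, y)\<close> would lie between \<open>(j, z)\<close> and \<open>(i, x)\<close>, against
  general position.\<close>

lemma ex_colinear_fiber:
  assumes X: "general_position P X" and j: "j \<in> pverts G" and z: "(j, z) \<in> X"
    and card_G: "card (pverts G) \<ge> 2"
    and card_X: "\<And>a. a \<in> pverts G \<Longrightarrow> card (Pair a -` X) \<ge> 2"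
  obtains i where "i \<in> pverts G" "colinear_set H (f j) (Pair i -` X)"
proof -
  have sub: "X \<subseteq> pverts G \<times> pverts H"
    using P.general_position_subset_verts[OF X] by simp
  have zH: "z \<in> pverts H" using sub z by auto
  let ?N = "{k. (j, k) \<in> parcs G}"
  let ?m = "\<lambda>k. int (gdist H z (f k)) - int (gdist H (f j) (f k))"
  have "finite ?N"
    using G.in_arcsD2 by (intro finite_subset[OF _ G.pair_finite_verts]) auto
  moreover have "?N \<noteq> {}"
  proof
    assume "?N = {}"
    \<comment> \<open>Without arcs leaving \<open>j\<close>, the property of being \<open>j\<close>
      is preserved along arcs vacuously, so connectedness makes \<open>j\<close> the only
      vertex.\<close>
    then have "y = j" if "y \<in> pverts G" for y
      using G.verts_induct[OF j that, of "\<lambda>v. v = j"] by auto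
    then have "pverts G \<subseteq> {j}" by blast
    from card_mono[OF _ this] card_G show False by simp
  qed
  ultimately obtain i where i: "(j, i) \<in> parcs G" and min: "\<And>k. (j, k) \<in> parcs G \<Longrightarrow> ?m i \<le> ?m k"
    using arg_min_if_finite(1)[of ?N ?m] arg_min_least[of ?N _ ?m] by blast
  have iG: "i \<in> pverts G" by (rule G.in_arcsD2[OF i])
  have ne: "j \<noteq> i" by (rule G.no_loops'[OF i])
  have not_between: "gdist H x (f j) \<noteq> gdist H x y + gdist H y (f j)"
    if xy: "(i, x) \<in> X" "(i, y) \<in> X" "x \<noteq> y" for x y
  proof -
    have v: "x \<in> pverts H" "y \<in> pverts H" using sub xy by auto
    have "gdist P (j, z) (i, x) \<noteq> gdist P (j, z) (i, y) + gdist P (i, y) (i, x)"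
      using X z xy ne unfolding P.general_position_iff by (metis prod.inject)
    moreover have "gdist P (j, z) (i, x) = gdist H z (f i) + 1 + gdist H (f j) x"
      "gdist P (j, z) (i, y) = gdist H z (f i) + 1 + gdist H (f j) y"
      using gdist_neighbour[OF i zH] v min by auto
    moreover have "gdist P (i, y) (i, x) = gdist H x y"
      using v iG by (simp add: gdist_fiber H.gdist_commute)
    moreover have "gdist H (f j) x = gdist H x (f j)" "gdist H (f j) y = gdist H y (f j)"
      using v j by (auto intro: H.gdist_commute)
    ultimately show ?thesis by simp
  qed
  \<comment> \<open>A second element \<open>x\<close> of the slice exists since the slice has at
    least two; \<open>f j\<close> trivially lies between \<open>x\<close> and
    \<open>f j\<close>.\<close>
  have "(i, f j) \<notin> X"
  proof
    assume fj: "(i, f j) \<in> X"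
    have "\<not> Pair i -` X \<subseteq> {f j}"
      using card_mono[of "{f j}" "Pair i -` X"] card_X[OF iG] by auto
    then obtain x where "(i, x) \<in> X" "x \<noteq> f j" by auto
    with not_between[of x "f j"] fj j show False by simp
  qed
  then have "colinear_set H (f j) (Pair i -` X)"
    using not_between general_position_fiber[OF X iG]
    by (auto simp: colinear_set_def interval_def)
  with iG show thesis by (rule that)
qed

section \<open>Constant maps\<close>

text \<open>The vertices \<open>(c, u)\<close> carry a copy of \<open>G\<close>, and they are the
  only ones where links attach. A path between different fibres must therefore leave and enter at
  \<open>u\<close>.\<close>

lemma gdist_constant:
  assumes const: "\<And>a. a \<in> pverts G \<Longrightarrow> f a = u"
    and v: "a \<in> pverts G" "a' \<in> pverts G" "b \<in> pverts H" "b' \<in> pverts H" and ne: "a \<noteq> a'"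
  shows "gdist P (a, b) (a', b') = gdist H b u + gdist G a a' + gdist H u b'"
proof (rule antisym)
  have u: "u \<in> pverts H" using f_in[OF v(1)] const[OF v(1)] by simp
  have "int (gdist P (a, u) (a', u)) \<le> int (gdist P (a, u) (a, u)) + int (gdist G a a')"
    using v(1,2)
  proof (rule G.gdist_lipschitz[where \<phi> = "\<lambda>c. int (gdist P (a, u) (c, u))"])
    fix c c' assume cc': "(c, c') \<in> parcs G"
    then have "((c, u), (c', u)) \<in> parcs P"
      using link_arc[OF cc'] const G.in_arcsD1[OF cc'] G.in_arcsD2[OF cc'] by simp
    then show "int (gdist P (a, u) (c', u)) \<le> int (gdist P (a, u) (c, u)) + 1"
      using P.gdist_arc_le[of "(a, u)" "(c, u)" "(c', u)"] u v by simp
  qed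
  then have "gdist P (a, u) (a', u) \<le> gdist G a a'" using u v by simp
  moreover have "gdist P (a, b) (a', b') \<le> gdist P (a, b) (a, u) + gdist P (a, u) (a', b')"
    using u v by (intro P.gdist_triangle) auto
  moreover have "gdist P (a, u) (a', b') \<le> gdist P (a, u) (a', u) + gdist P (a', u) (a', b')"
    using u v by (intro P.gdist_triangle) auto
  ultimately show "gdist P (a, b) (a', b') \<le> gdist H b u + gdist G a a' + gdist H u b'"
    using u v by (simp add: gdist_fiber)
  \<comment> \<open>This is the claimed distance from \<open>(a, b)\<close> itself, checked to grow
    by at most one along every arc.\<close>
  define \<phi> where "\<phi> = (\<lambda>(c, d). if c = a then int (gdist H b d)
    else int (gdist H b u) + int (gdist G a c) + int (gdist H u d))"
  have "\<phi> (a', b') \<le> \<phi> (a, b) + int (gdist P (a, b) (a', b'))"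
  proof (rule P.gdist_lipschitz)
    fix p q assume "(p, q) \<in> parcs P"
    then show "\<phi> q \<le> \<phi> p + 1"
    proof (cases rule: arc_P_cases)
      case (fiber c d d')
      then show ?thesis
        using H.gdist_arc_le[of b d d'] H.gdist_arc_le[of u d d'] u v by (simp add: \<phi>_def)
    next
      case (link c c')
      have "f c = u" "f c' = u"
        using const G.in_arcsD1[OF link(3)] G.in_arcsD2[OF link(3)] by auto
      then show ?thesis
        using link G.gdist_arc_le[OF v(1) link(3)] u v by (auto simp: \<phi>_def)
    qed
  qed (use v in auto)
  then show "gdist H b u + gdist G a a' + gdist H u b' \<le> gdist P (a, b) (a', b')"
    using v ne by (simp add: \<phi>_def)
qed

lemma general_position_constant:
  assumes const: "\<And>a. a \<in> pverts G \<Longrightarrow> f a = u" and u: "u \<in> pverts H"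
    and S: "colinear_set H u S"
  shows "general_position P (pverts G \<times> S)"
proof -
  have gpS: "general_position H S" by (rule H.colinear_set_general_position[OF S])
  have sub: "S \<subseteq> pverts H" by (rule H.general_position_subset_verts[OF gpS])
  have not_between: "gdist H x u \<noteq> gdist H x y + gdist H y u" if "x \<in> S" "y \<in> S" "x \<noteq> y" for x y
    using S that sub by (auto simp: colinear_set_def interval_def)
  have pos: "gdist H y u > 0" if "y \<in> S" for y
    using S that sub u H.gdist_eq_0_iff[of y u] by (auto simp: colinear_set_def)
  have "gdist P (a, x) (c, z) \<noteq> gdist P (a, x) (b, y) + gdist P (b, y) (c, z)"
    if abc: "a \<in> pverts G" "b \<in> pverts G" "c \<in> pverts G" and xyz: "x \<in> S" "y \<in> S" "z \<in> S"
      and ne: "(a, x) \<noteq> (b, y)" "(b, y) \<noteq> (c, z)" "(a, x) \<noteq> (c, z)" for a b c x y z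
  proof -
    have v: "x \<in> pverts H" "y \<in> pverts H" "z \<in> pverts H" using sub xyz by auto
    have comm: "gdist H u x = gdist H x u" "gdist H u y = gdist H y u" "gdist H u z = gdist H z u"
      "gdist H z y = gdist H y z"
      using v u by (auto intro: H.gdist_commute)
    note dist = gdist_constant[OF const] gdist_fiber
    \<comment> \<open>The middle vertex is \<open>(b, y)\<close>. In one fibre, general position of
      \<open>S\<close> applies. If it shares a fibre with exactly one end, colinearity applies. If
      it is alone in its fibre, the route through it pays the positive distance from
      \<open>y\<close> to \<open>u\<close> twice, and the triangle inequality makes it too
      long.\<close>
    consider "a = b" "b = c" | "a = b" "b \<noteq> c" | "a \<noteq> b" "b = c" | "a \<noteq> b" "b \<noteq> c" "a = c"
      | "a \<noteq> b" "b \<noteq> c" "a \<noteq> c" by blast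
    then show ?thesis
    proof cases
      case 1
      then show ?thesis
        using gpS xyz ne abc v by (auto simp: dist H.general_position_iff)
    next
      case 2
      then show ?thesis
        using not_between[of x y] xyz ne abc v by (auto simp: dist)
    next
      case 3
      then show ?thesis
        using not_between[of z y] xyz ne abc v comm by (auto simp: dist)
    next
      case 4
      then show ?thesis
        using H.gdist_triangle[of x u z] pos[OF xyz(2)] abc v u comm by (auto simp: dist)
    next
      case 5
      then show ?thesis
        using G.gdist_triangle[OF abc] pos[OF xyz(2)] abc v u comm by (auto simp: dist)
    qed
  qed
  then show ?thesis
    using sub by (auto simp: P.general_position_iff)
qed

section \<open>The equality case\<close>

text \<open>Equality in the fibrewise bound forces every slice of a largest \<open>X\<close> to have
  \<open>gp H\<close> elements, and one of these slices is colinear.\<close>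

lemma gp_le_xi_of_gp_P_eq:
  assumes eq: "gp P = card (pverts G) * gp H"
    and card_G: "card (pverts G) \<ge> 2" and card_H: "card (pverts H) \<ge> 2"
  shows "gp H \<le> xi H"
proof -
  obtain X where X: "general_position P X" "card X = gp P"
    by (rule P.gp_attained)
  have le: "card (Pair a -` X) \<le> gp H" if "a \<in> pverts G" for a
    by (intro H.card_le_gp general_position_fiber X(1) that)
  have "(\<Sum>a\<in>pverts G. card (Pair a -` X)) = (\<Sum>a\<in>pverts G. gp H)"
    using card_eq_sum_fibers[of X] P.general_position_subset_verts[OF X(1)] X(2) eq by simp
  then have card_X: "card (Pair a -` X) = gp H" if "a \<in> pverts G" for a
    using sum_mono_inv[OF _ le that G.pair_finite_verts] by simp
  \<comment> \<open>This provides both a point \<open>(j, z)\<close> of \<open>X\<close> and the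
    two-element slices needed for colinearity.\<close>
  have gp2: "gp H \<ge> 2" by (rule H.gp_ge_2[OF card_H])
  obtain j where j: "j \<in> pverts G" using card_G by fastforce
  have "Pair j -` X \<noteq> {}" using card_X[OF j] gp2 by auto
  then obtain z where "(j, z) \<in> X" by auto
  then obtain i where "i \<in> pverts G" "colinear_set H (f j) (Pair i -` X)"
    using ex_colinear_fiber[OF X(1) j _ card_G] card_X gp2 by metis
  then show ?thesis
    using H.card_colinear_le_xi[OF f_in[OF j]] card_X by metis
qed

end

section \<open>Extrema over all maps\<close>

theorem theorem4p2:
  fixes G :: "'a pair_pre_digraph" and H :: "'b pair_pre_digraph"
  assumes "pair_graph G" and "pair_graph H"
    and "connected (with_proj G)" and "connected (with_proj H)"
    and "card (pverts G) \<ge> 2" and "card (pverts H) \<ge> 2"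
  shows "gp H \<le> lower_gp_sierpinski G H
    \<and> lower_gp_sierpinski G H \<le> gp_sierpinski G H
    \<and> gp_sierpinski G H \<le> card (pverts G) * gp H
    \<and> (gp_sierpinski G H = card (pverts G) * gp H \<longleftrightarrow> gp H = xi H)"
proof -
  interpret G: connected_graph G
    using assms by (simp add: connected_graph_def connected_graph_axioms_def)
  interpret H: connected_graph H
    using assms by (simp add: connected_graph_def connected_graph_axioms_def)
  let ?F = "pverts G \<rightarrow>\<^sub>E pverts H"
  let ?A = "(\<lambda>f. gp (sierpinski_product G f H)) ` ?F"
  have neH: "pverts H \<noteq> {}" using assms(6) by auto
  have prod: "sierpinski G H f" if "f \<in> ?F" for f
    by unfold_locales (use that in auto)
  have fin: "finite ?A"
    using G.pair_finite_verts H.pair_finite_verts by (intro finite_imageI finite_PiE) auto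
  have ne: "?A \<noteq> {}" using neH by (simp add: PiE_eq_empty_iff)
  have lower: "gp H \<le> lower_gp_sierpinski G H"
    unfolding lower_gp_sierpinski_def using fin ne sierpinski.gp_le_gp_P[OF prod]
    by (subst Min_ge_iff) auto
  have mid: "lower_gp_sierpinski G H \<le> gp_sierpinski G H"
    unfolding lower_gp_sierpinski_def gp_sierpinski_def
    using fin ne by (meson Max_ge Min_in)
  have upper: "gp_sierpinski G H \<le> card (pverts G) * gp H"
    unfolding gp_sierpinski_def using fin ne sierpinski.gp_P_le[OF prod]
    by (subst Max_le_iff) auto
  have "gp H = xi H" if eq: "gp_sierpinski G H = card (pverts G) * gp H"
  proof -
    have "gp_sierpinski G H \<in> ?A"
      unfolding gp_sierpinski_def by (rule Max_in[OF fin ne])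
    then obtain f where f: "f \<in> ?F" "gp (sierpinski_product G f H) = card (pverts G) * gp H"
      using eq by auto
    show ?thesis
      using sierpinski.gp_le_xi_of_gp_P_eq[OF prod[OF f(1)] f(2) assms(5,6)] H.xi_le_gp[OF neH]
      by simp
  qed
  moreover have "gp_sierpinski G H = card (pverts G) * gp H" if eq: "gp H = xi H"
  proof -
    obtain u S where u: "u \<in> pverts H" and S: "colinear_set H u S" "card S = gp H"
      using H.xi_attained[OF neH] eq by metis
    \<comment> \<open>The constant map is restricted to \<open>pverts G\<close> so that it belongs
      to the extensional function space.\<close>
    let ?f = "\<lambda>a\<in>pverts G. u"
    have f: "?f \<in> ?F" using u by auto
    interpret sierpinski G H ?f by (rule prod[OF f])
    have "card (pverts G \<times> S) \<le> gp (sierpinski_product G ?f H)"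
      using u S by (intro P.card_le_gp general_position_constant[of u]) auto
    also have "\<dots> \<le> gp_sierpinski G H"
      unfolding gp_sierpinski_def using fin f by (intro Max_ge) auto
    finally show ?thesis using upper S(2) by (simp add: card_cartesian_product)
  qed
  ultimately show ?thesis using lower mid upper by blast
qed

end
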